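(* Let $m,n,N\ge 1$, let $W,W^\star,G\in\mathbb{R}^{m\times n}$, $Z\in\mathbb{R}^{n\times N}$, and $H\in\mathbb{R}^{m\times m}$ symmetric. Assume that $H\succ 0$, $ZZ^\top\succ 0$ and $$G=\tfrac1N\,H\,(W-W^\star)\,ZZ^\top .$$ Assume moreover that $(W-W^\star)(W-W^\star)^\top\propto I_m$ and that $ZZ^\top\propto I_n$. Let $Q^\star$ be the unique minimizer over $Q\in\mathbb{R}^{m\times n}$ of $$J(Q)=-\mathrm{tr}(QG^\top)+\frac{1}{2N}\mathrm{tr}\big(H\,Q\,ZZ^\top Q^\top\big).$$ Then $$Q^\star\propto \mathrm{msgn}(G).$$
   Context: For a real matrix $X$ with compact singular value decomposition $X=USV^\top$ ($U,V$ with orthonormal columns, $S$ diagonal with positive entries, of size $\mathrm{rank}(X)$), the matrix sign is $\mathrm{msgn}(X):=UV^\top$, with $\mathrm{msgn}(0)=0$. For matrices $A,B$ of the same size, $A\propto B$ means $A=cB$ for some scalar $c>0$. $A\succ0$ means symmetric positive definite. *)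

theory Defs
  imports Complex_Main "Jordan_Normal_Form.DL_Rank"
begin

definition mat_trace :: "real mat \<Rightarrow> real" where
  "mat_trace A = (\<Sum>i<dim_row A. A $$ (i, i))"

definition pos_def_mat :: "real mat \<Rightarrow> bool" where
  "pos_def_mat A \<longleftrightarrow> square_mat A \<and> transpose_mat A = A \<and>
     (\<forall>x \<in> carrier_vec (dim_row A). x \<noteq> 0\<^sub>v (dim_row A) \<longrightarrow> 0 < x \<bullet> (A *\<^sub>v x))"

definition pos_prop :: "real mat \<Rightarrow> real mat \<Rightarrow> bool" (infix "\<propto>" 50) where
  "A \<propto> B \<longleftrightarrow> (\<exists>c>0. A = c \<cdot>\<^sub>m B)"

definition compact_svd :: "real mat \<Rightarrow> real mat \<Rightarrow> real mat \<Rightarrow> real mat \<Rightarrow> bool" where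
  "compact_svd X U S V \<longleftrightarrow>
     (let r = vec_space.rank (dim_row X) X in
        U \<in> carrier_mat (dim_row X) r \<and> transpose_mat U * U = 1\<^sub>m r \<and>
        V \<in> carrier_mat (dim_col X) r \<and> transpose_mat V * V = 1\<^sub>m r \<and>
        S \<in> carrier_mat r r \<and> diagonal_mat S \<and> (\<forall>i<r. 0 < S $$ (i, i)) \<and>
        X = U * S * transpose_mat V)"

text \<open>Compact singular value decompositions are not unique, but the product of the outer
  factors is, which is why a definite description is used.\<close>

definition msgn :: "real mat \<Rightarrow> real mat" where
  "msgn X = (if X = 0\<^sub>m (dim_row X) (dim_col X) then 0\<^sub>m (dim_row X) (dim_col X)
     else (THE Y. \<exists>U S V. compact_svd X U S V \<and> Y = U * transpose_mat V))"

definition objective :: "nat \<Rightarrow> real mat \<Rightarrow> real mat \<Rightarrow> real mat \<Rightarrow> real mat \<Rightarrow> real" where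
  "objective N H Z G Q =
     - mat_trace (Q * transpose_mat G)
     + 1 / (2 * real N) * mat_trace (H * Q * (Z * transpose_mat Z) * transpose_mat Q)"

end

theory Submission
  imports Defs "Jordan_Normal_Form.Schur_Decomposition" "Jordan_Normal_Form.Spectral_Radius"
begin

text \<open>Let \<open>D = W - Wstar\<close>, \<open>D D\<^sup>T = c I\<close> and \<open>Z Z\<^sup>T = d I\<close>. Then \<open>G = (d/N) H D\<close>, and completing the
  square shows that the objective is, up to a constant, a positive multiple of
  \<open>tr ((Q - D)\<^sup>T H (Q - D))\<close>, so that \<open>D\<close> is the unique minimizer. On the other hand
  \<open>G = K Y\<close> with \<open>K\<close> a positive multiple of \<open>H\<close> and \<open>Y = D / sqrt c\<close>, where \<open>Y Y\<^sup>T = I\<close>. This is a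
  polar decomposition, hence \<open>msgn G = Y\<close>: diagonalizing \<open>K\<close> gives a compact singular value
  decomposition of \<open>G\<close>, and for any such decomposition \<open>U S V\<^sup>T\<close> the matrix \<open>U S U\<^sup>T\<close> is a positive
  definite square root of \<open>G G\<^sup>T = K\<^sup>2\<close>, so it is \<open>K\<close> and \<open>U V\<^sup>T = Y\<close>.\<close>

section \<open>Spectral theorem for real symmetric matrices\<close>

lemma conjugate_real_mat_mult_vec:
  assumes A: "A \<in> carrier_mat nr nc" and w: "w \<in> carrier_vec nc"
  shows "conjugate (map_mat complex_of_real A *\<^sub>v w) = map_mat complex_of_real A *\<^sub>v conjugate w"
  using assms by (intro eq_vecI) (auto simp: scalar_prod_def)

text \<open>Over the complex numbers an eigenvalue always exists, and symmetry forces it to be real.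
  It is then a real root of the characteristic polynomial of \<open>A\<close>, which gives an
  eigenvector with real entries.\<close>

lemma real_symmetric_eigenvector_exists:
  fixes A :: "real mat"
  assumes A: "A \<in> carrier_mat n n" and sym: "transpose_mat A = A" and n: "n > 0"
  shows "\<exists>v e. v \<in> carrier_vec n \<and> v \<noteq> 0\<^sub>v n \<and> A *\<^sub>v v = e \<cdot>\<^sub>v v"
proof -
  let ?C = "map_mat complex_of_real A"
  have C: "?C \<in> carrier_mat n n" using A by simp
  have Csym: "transpose_mat ?C = ?C" using sym by (metis map_mat_transpose)
  obtain l where l: "eigenvalue ?C l"
    using spectrum_non_empty[OF C n] unfolding spectrum_def by auto
  then obtain w where w: "w \<in> carrier_vec n" "w \<noteq> 0\<^sub>v n" "?C *\<^sub>v w = l \<cdot>\<^sub>v w"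
    unfolding eigenvalue_def eigenvector_def using A by auto
  have cw: "conjugate w \<in> carrier_vec n" using w by simp
  have "?C *\<^sub>v conjugate w = cnj l \<cdot>\<^sub>v conjugate w"
    using conjugate_real_mat_mult_vec[OF A w(1)] w(3) by (simp add: conjugate_smult_vec)
  \<comment> \<open>The number \<open>conjugate w \<bullet> (?C *\<^sub>v w)\<close> is evaluated in
    two ways, once letting the matrix act on \<open>conjugate w\<close> and once on
    \<open>w\<close>. The common factor \<open>conjugate w \<bullet> w\<close> is a squared norm and
    does not vanish.\<close>
  hence "cnj l * (conjugate w \<bullet> w) = (transpose_mat ?C *\<^sub>v conjugate w) \<bullet> w"
    unfolding Csym using w cw by simp
  also have "\<dots> = conjugate w \<bullet> (?C *\<^sub>v w)"
    by (rule transpose_vec_mult_scalar[OF C w(1) cw])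
  also have "\<dots> = l * (conjugate w \<bullet> w)" using w cw by simp
  finally have "(cnj l - l) * (conjugate w \<bullet> w) = 0" by (simp add: algebra_simps)
  moreover have "conjugate w \<bullet> w \<noteq> 0"
    using conjugate_square_eq_0_vec[OF w(1)] w(2) comm_scalar_prod[OF w(1) cw] by simp
  ultimately have "cnj l = l" by simp
  then obtain e where e: "l = complex_of_real e"
    by (metis Reals_cases Reals_cnj_iff)
  \<comment> \<open>The vector \<open>w\<close> itself may have non-real entries, so the return to
    the reals goes through the characteristic polynomial instead of through
    \<open>w\<close>.\<close>
  have "poly (char_poly ?C) l = 0"
    using l eigenvalue_root_char_poly[OF C] by simp
  hence "poly (char_poly A) e = 0"
    unfolding of_real_hom.char_poly_hom[OF A] e by simp
  hence "eigenvalue A e" using eigenvalue_root_char_poly[OF A] by simp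
  thus ?thesis unfolding eigenvalue_def eigenvector_def using A by auto
qed

text \<open>Gram-Schmidt, applied to a basis that starts with \<open>v\<close>, leaves the first
  vector unchanged. Its output is orthogonal but not normalized, so the columns are rescaled, and
  \<open>c\<close> is the reciprocal of the norm of \<open>v\<close>.\<close>

lemma orthogonal_matrix_with_first_col:
  fixes v :: "real vec"
  assumes v: "v \<in> carrier_vec n" and v0: "v \<noteq> 0\<^sub>v n"
  shows "\<exists>P c. P \<in> carrier_mat n n \<and> transpose_mat P * P = 1\<^sub>m n \<and> col P 0 = c \<cdot>\<^sub>v v"
proof -
  interpret cof_vec_space n "TYPE(real)" .
  define b where "b = basis_completion v"
  define ws where "ws = gram_schmidt n b"
  note bc = basis_completion[OF v v0, folded b_def]
  have n: "n > 0" using v v0 by (cases n) (auto intro!: eq_vecI)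
  obtain vs where b: "b = v # vs" using bc(6,7) n by (cases b) auto
  note gs = gram_schmidt_result[OF bc(2,4,5) ws_def]
  have len: "length ws = n" using gs(4) bc(6) by simp
  have hd: "ws ! 0 = v"
    using gram_schmidt_hd[OF v, of vs] len n unfolding ws_def b by (metis hd_conv_nth list.size(3) not_less_zero)
  have wsc: "ws ! i \<in> carrier_vec n" if "i < n" for i
    using gs(3) len that nth_mem by blast
  define P where "P = mat n n (\<lambda>(i,j). ws ! j $ i / sqrt (ws ! j \<bullet> ws ! j))"
  have P: "P \<in> carrier_mat n n" unfolding P_def by simp
  have colP: "col P j = (1 / sqrt (ws ! j \<bullet> ws ! j)) \<cdot>\<^sub>v (ws ! j)" if "j < n" for j
    using that wsc[OF that] by (intro eq_vecI) (auto simp: P_def)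
  \<comment> \<open>For \<open>i = j\<close> the equivalence says that the vectors are nonzero,
    which makes the divisors in \<open>P\<close> positive.\<close>
  have orth: "(ws ! i \<bullet> ws ! j = 0) = (i \<noteq> j)" if "i < n" "j < n" for i j
    using corthogonalD[OF gs(2), of i j] that len by simp
  have pos: "ws ! i \<bullet> ws ! i > 0" if "i < n" for i
    using orth[OF that that] conjugate_square_ge_0_vec[of "ws ! i"] by simp
  have "transpose_mat P * P = 1\<^sub>m n"
  proof (rule eq_matI)
    fix i j assume "i < dim_row (1\<^sub>m n :: real mat)" "j < dim_col (1\<^sub>m n :: real mat)"
    hence ij: "i < n" "j < n" by auto
    have "(transpose_mat P * P) $$ (i,j) = col P i \<bullet> col P j" using ij P by simp
    also have "\<dots> = (ws ! i \<bullet> ws ! j) / (sqrt (ws ! i \<bullet> ws ! i) * sqrt (ws ! j \<bullet> ws ! j))"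
      unfolding colP[OF ij(1)] colP[OF ij(2)] using wsc[OF ij(1)] wsc[OF ij(2)] by simp
    also have "\<dots> = 1\<^sub>m n $$ (i,j)"
      using orth[OF ij] pos[OF ij(1)] ij by (cases "i = j") auto
    finally show "(transpose_mat P * P) $$ (i,j) = 1\<^sub>m n $$ (i,j)" .
  qed (use P in auto)
  thus ?thesis using P colP[OF n] hd by auto
qed

lemma orthogonal_transpose_right_inverse:
  fixes P :: "real mat"
  assumes "P \<in> carrier_mat n n" "transpose_mat P * P = 1\<^sub>m n"
  shows "P * transpose_mat P = 1\<^sub>m n"
  by (rule mat_mult_left_right_inverse[OF _ assms(1) assms(2)]) (use assms in simp)

lemma diagonal_mat_four_block:
  assumes "A \<in> carrier_mat a a" "D \<in> carrier_mat d d" "diagonal_mat A" "diagonal_mat D"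
  shows "diagonal_mat (four_block_mat A (0\<^sub>m a d) (0\<^sub>m d a) D)"
proof -
  have "A $$ (i,j) = 0" if "i < a" "j < a" "i \<noteq> j" for i j
    using assms(1,3) that unfolding diagonal_mat_def by simp
  moreover have "D $$ (i,j) = 0" if "i < d" "j < d" "i \<noteq> j" for i j
    using assms(2,4) that unfolding diagonal_mat_def by simp
  ultimately show ?thesis
    unfolding diagonal_mat_def using assms(1,2) by simp
qed

text \<open>Deflation: an orthogonal change of basis that puts an eigenvector first clears the rest
  of the first column, and by symmetry the rest of the first row. The induction hypothesis
  diagonalizes the remaining block.\<close>

theorem real_symmetric_diagonalization:
  fixes A :: "real mat"
  assumes "A \<in> carrier_mat n n" and "transpose_mat A = A"
  shows "\<exists>P D. P \<in> carrier_mat n n \<and> D \<in> carrier_mat n n \<and> transpose_mat P * P = 1\<^sub>m n \<and>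
           diagonal_mat D \<and> A = P * D * transpose_mat P"
  using assms
proof (induction n arbitrary: A)
  case 0
  show ?case
    by (intro exI[of _ "0\<^sub>m 0 0"]) (use 0 in \<open>auto simp: diagonal_mat_def\<close>)
next
  case (Suc n A)
  note A = Suc.prems(1)
  obtain v e where v: "v \<in> carrier_vec (Suc n)" "v \<noteq> 0\<^sub>v (Suc n)" "A *\<^sub>v v = e \<cdot>\<^sub>v v"
    using real_symmetric_eigenvector_exists[OF Suc.prems] by auto
  obtain P c where P: "P \<in> carrier_mat (Suc n) (Suc n)" and PP: "transpose_mat P * P = 1\<^sub>m (Suc n)"
    and Pv: "col P 0 = c \<cdot>\<^sub>v v"
    using orthogonal_matrix_with_first_col[OF v(1,2)] by auto
  have PPt: "P * transpose_mat P = 1\<^sub>m (Suc n)"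
    by (rule orthogonal_transpose_right_inverse[OF P PP])
  have Pt: "transpose_mat P \<in> carrier_mat (Suc n) (Suc n)" using P by simp
  define B where "B = transpose_mat P * (A * P)"
  have B: "B \<in> carrier_mat (Suc n) (Suc n)" unfolding B_def using A P by auto
  have Bsym: "transpose_mat B = B"
    unfolding B_def using A P Pt Suc.prems(2)
    by (simp add: transpose_mult[of _ "Suc n" "Suc n" _ "Suc n"])
  have col0: "col (A * P) 0 = e \<cdot>\<^sub>v col P 0"
  proof -
    have "col (A * P) 0 = A *\<^sub>v col P 0" using A P by auto
    also have "\<dots> = c \<cdot>\<^sub>v (A *\<^sub>v v)" unfolding Pv using A v by (simp add: mult_mat_vec)
    also have "\<dots> = e \<cdot>\<^sub>v col P 0" unfolding Pv v(3) by (simp add: smult_smult_assoc mult.commute)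
    finally show ?thesis .
  qed
  \<comment> \<open>Since \<open>A\<close> scales the first column of \<open>P\<close> by
    \<open>e\<close>, the first column of \<open>B\<close> is \<open>e\<close> times the first
    column of \<open>transpose_mat P * P\<close>, the identity.\<close>
  have B0: "B $$ (i,0) = (if i = 0 then e else 0)" if "i < Suc n" for i
  proof -
    have "B $$ (i,0) = col P i \<bullet> col (A * P) 0" unfolding B_def using that A P by simp
    also have "\<dots> = e * (transpose_mat P * P) $$ (i,0)" unfolding col0 using that P by simp
    finally show ?thesis unfolding PP using that by simp
  qed
  obtain B1 B2 B3 B4 where split: "split_block B 1 1 = (B1, B2, B3, B4)"
    by (cases "split_block B 1 1") auto
  have dims: "dim_row B = 1 + n" "dim_col B = 1 + n" using B by auto
  note sb = split_block[OF split dims]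
  have B30: "B3 = 0\<^sub>m n 1"
  proof (rule eq_matI)
    fix i j assume "i < dim_row (0\<^sub>m n 1 :: real mat)" "j < dim_col (0\<^sub>m n 1 :: real mat)"
    hence ij: "i < n" "j = 0" by auto
    have "B3 $$ (i,j) = B $$ (Suc i, 0)" unfolding sb(5) using ij sb(1-4) by simp
    thus "B3 $$ (i,j) = 0\<^sub>m n 1 $$ (i,j)" using B0[of "Suc i"] ij by simp
  qed (use sb in auto)
  \<comment> \<open>This is a second block form of \<open>B\<close>, with transposed blocks. Reading
    one entry of \<open>B\<close> through both forms relates \<open>B2\<close> to \<open>B3\<close>
    and shows that \<open>B4\<close> is symmetric.\<close>
  note tr = transpose_four_block_mat[OF sb(1-4), folded sb(5), unfolded Bsym]
  have "B2 = transpose_mat B3"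
  proof (rule eq_matI)
    fix i j assume "i < dim_row (transpose_mat B3)" "j < dim_col (transpose_mat B3)"
    hence ij: "i < 1" "j < n" using sb by auto
    have "B2 $$ (i,j) = B $$ (i, Suc j)" unfolding sb(5) using ij sb(1-4) by simp
    also have "\<dots> = transpose_mat B3 $$ (i,j)" unfolding tr using ij sb(1-4) by simp
    finally show "B2 $$ (i,j) = transpose_mat B3 $$ (i,j)" .
  qed (use sb in auto)
  hence B20: "B2 = 0\<^sub>m 1 n" unfolding B30 by simp
  have "transpose_mat B4 = B4"
  proof (rule eq_matI)
    fix i j assume "i < dim_row B4" "j < dim_col B4"
    hence ij: "i < n" "j < n" using sb by auto
    have "B4 $$ (i,j) = B $$ (Suc i, Suc j)" unfolding sb(5) using ij sb(1-4) by simp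
    also have "\<dots> = transpose_mat B4 $$ (i,j)" unfolding tr using ij sb(1-4) by simp
    finally show "transpose_mat B4 $$ (i,j) = B4 $$ (i,j)" by simp
  qed (use sb in auto)
  from Suc.IH[OF sb(4) this] obtain P' D' where
    P': "P' \<in> carrier_mat n n" "transpose_mat P' * P' = 1\<^sub>m n" and
    D': "D' \<in> carrier_mat n n" "diagonal_mat D'" and
    B4: "B4 = P' * D' * transpose_mat P'" by auto
  \<comment> \<open>The diagonalization of the smaller block is bordered by a trivial first
    coordinate; the corner of \<open>D\<close> is the eigenvalue block \<open>B1\<close>.\<close>
  define Q where "Q = four_block_mat (1\<^sub>m 1) (0\<^sub>m 1 n) (0\<^sub>m n 1) P'"
  define D where "D = four_block_mat B1 (0\<^sub>m 1 n) (0\<^sub>m n 1) D'"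
  have Q: "Q \<in> carrier_mat (Suc n) (Suc n)" unfolding Q_def using P' by auto
  have D: "D \<in> carrier_mat (Suc n) (Suc n)" unfolding D_def using D' sb(1) by auto
  have Qt: "transpose_mat Q = four_block_mat (1\<^sub>m 1) (0\<^sub>m 1 n) (0\<^sub>m n 1) (transpose_mat P')"
    unfolding Q_def using P' by (subst transpose_four_block_mat[of _ 1 1 _ n _ n]) auto
  have QQ: "transpose_mat Q * Q = 1\<^sub>m (Suc n)"
    unfolding Qt unfolding Q_def using P'
    by (subst mult_four_block_mat[of _ 1 1 _ n _ n _ _ 1 _ n])
      (auto simp: left_mult_zero_mat[of _ n] right_mult_zero_mat[of _ _ n])
  have BQ: "B = Q * D * transpose_mat Q"
  proof -
    have "Q * D = four_block_mat B1 (0\<^sub>m 1 n) (0\<^sub>m n 1) (P' * D')"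
      unfolding Q_def D_def using P' D' sb(1)
      by (subst mult_four_block_mat[of _ 1 1 _ n _ n _ _ 1 _ n])
        (auto simp: left_mult_zero_mat[of _ n] right_mult_zero_mat[of _ _ n])
    also have "\<dots> * transpose_mat Q = four_block_mat B1 (0\<^sub>m 1 n) (0\<^sub>m n 1) B4"
      unfolding Qt B4 using P' D' sb(1)
      by (subst mult_four_block_mat[of _ 1 1 _ n _ n _ _ 1 _ n])
        (auto simp: left_mult_zero_mat[of _ n] right_mult_zero_mat[of _ _ n])
    finally show ?thesis unfolding sb(5) B20 B30 by simp
  qed
  have diag: "diagonal_mat D"
    unfolding D_def by (rule diagonal_mat_four_block) (use sb D' in \<open>auto simp: diagonal_mat_def\<close>)
  note mc = mult_carrier_mat[of _ "Suc n" "Suc n" _ "Suc n"]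
  note as = assoc_mult_mat[of _ "Suc n" "Suc n" _ "Suc n" _ "Suc n"]
  have "A = (P * transpose_mat P) * A * (P * transpose_mat P)" unfolding PPt using A by simp
  also have "\<dots> = P * B * transpose_mat P"
    unfolding B_def using A P Pt by (simp add: as mc)
  also have "\<dots> = (P * Q) * D * transpose_mat (P * Q)"
    unfolding BQ using Q D P Pt by (simp add: as mc transpose_mult[OF P Q])
  finally have eq: "A = (P * Q) * D * transpose_mat (P * Q)" .
  have "transpose_mat (P * Q) * (P * Q) = transpose_mat Q * ((transpose_mat P * P) * Q)"
    unfolding transpose_mult[OF P Q] using P Q Pt by (simp add: as mc)
  also have "\<dots> = 1\<^sub>m (Suc n)" unfolding PP using Q QQ by simp
  finally show ?case using eq diag D P Q by (intro exI[of _ "P * Q"] exI[of _ D]) auto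
qed

section \<open>Scalar multiples and traces\<close>

lemma smult_smult_mat: "a \<cdot>\<^sub>m (b \<cdot>\<^sub>m A) = (a * b) \<cdot>\<^sub>m (A :: 'a :: semigroup_mult mat)"
  by (rule eq_matI) (auto simp: mult.assoc)

lemma mat_trace_mult_comm:
  assumes "A \<in> carrier_mat m n" "B \<in> carrier_mat n m"
  shows "mat_trace (A * B) = mat_trace (B * A)"
proof -
  have "mat_trace (A * B) = (\<Sum>i<m. \<Sum>j<n. A $$ (i,j) * B $$ (j,i))"
    using assms unfolding mat_trace_def by (auto simp: scalar_prod_def atLeast0LessThan)
  also have "\<dots> = (\<Sum>j<n. \<Sum>i<m. B $$ (j,i) * A $$ (i,j))"
    by (subst sum.swap) (simp add: mult.commute)
  also have "\<dots> = mat_trace (B * A)"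
    using assms unfolding mat_trace_def by (auto simp: scalar_prod_def atLeast0LessThan)
  finally show ?thesis .
qed

lemma mat_trace_add:
  assumes "A \<in> carrier_mat n n" "B \<in> carrier_mat n n"
  shows "mat_trace (A + B) = mat_trace A + mat_trace B"
  using assms unfolding mat_trace_def by (simp add: sum.distrib)

lemma mat_trace_minus:
  assumes "A \<in> carrier_mat n n" "B \<in> carrier_mat n n"
  shows "mat_trace (A - B) = mat_trace A - mat_trace B"
  using assms unfolding mat_trace_def by (simp add: sum_subtractf)

lemma mat_trace_smult:
  assumes "A \<in> carrier_mat n n"
  shows "mat_trace (c \<cdot>\<^sub>m A) = c * mat_trace A"
  using assms unfolding mat_trace_def by (simp add: sum_distrib_left)

lemma mat_trace_transpose:
  assumes "A \<in> carrier_mat n n"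
  shows "mat_trace (transpose_mat A) = mat_trace A"
  using assms unfolding mat_trace_def by simp

lemma mat_trace_zero: "mat_trace (0\<^sub>m n n) = 0"
  unfolding mat_trace_def by simp

lemma mat_trace_congruence:
  assumes A: "A \<in> carrier_mat m m" and E: "E \<in> carrier_mat m n"
  shows "mat_trace (transpose_mat E * (A * E)) = (\<Sum>j<n. col E j \<bullet> (A *\<^sub>v col E j))"
  unfolding mat_trace_def
proof (rule sum.cong)
  fix j assume "j \<in> {..<n}"
  hence j: "j < n" by simp
  have "col (A * E) j = A *\<^sub>v col E j" by (rule eq_vecI) (use j A E in auto)
  thus "(transpose_mat E * (A * E)) $$ (j,j) = col E j \<bullet> (A *\<^sub>v col E j)"
    using j A E by simp
qed (use E in auto)

section \<open>Positive definite matrices\<close>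

lemma pos_def_matD:
  assumes "pos_def_mat A" "A \<in> carrier_mat n n"
  shows "transpose_mat A = A"
    and "x \<in> carrier_vec n \<Longrightarrow> x \<noteq> 0\<^sub>v n \<Longrightarrow> 0 < x \<bullet> (A *\<^sub>v x)"
    and "x \<in> carrier_vec n \<Longrightarrow> 0 \<le> x \<bullet> (A *\<^sub>v x)"
proof -
  show "transpose_mat A = A" and
    pos: "x \<in> carrier_vec n \<Longrightarrow> x \<noteq> 0\<^sub>v n \<Longrightarrow> 0 < x \<bullet> (A *\<^sub>v x)"
    using assms unfolding pos_def_mat_def by auto
  show "0 \<le> x \<bullet> (A *\<^sub>v x)" if "x \<in> carrier_vec n"
    using pos that assms(2) by (cases "x = 0\<^sub>v n") auto
qed

lemma pos_def_mat_smult: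
  assumes "pos_def_mat A" "c > 0"
  shows "pos_def_mat (c \<cdot>\<^sub>m A)"
proof -
  obtain n where A: "A \<in> carrier_mat n n" 
    using assms(1) unfolding pos_def_mat_def by (metis carrier_matI square_mat.elims(2))
  have "transpose_mat (c \<cdot>\<^sub>m A) = c \<cdot>\<^sub>m transpose_mat A" by (rule eq_matI) auto
  moreover have "x \<bullet> ((c \<cdot>\<^sub>m A) *\<^sub>v x) = c * (x \<bullet> (A *\<^sub>v x))" if "x \<in> carrier_vec n" for x
  proof -
    have "(c \<cdot>\<^sub>m A) *\<^sub>v x = c \<cdot>\<^sub>v (A *\<^sub>v x)" using A that by (intro eq_vecI) auto
    thus ?thesis using A that by simp
  qed
  ultimately show ?thesis
    using pos_def_matD[OF assms(1) A] A assms(2) unfolding pos_def_mat_def by auto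
qed

text \<open>The trace sums the quadratic form of \<open>A\<close> over the columns of
  \<open>E\<close>, so it is a squared norm of \<open>E\<close>. It serves below for cancellation,
  for uniqueness of square roots and for uniqueness of the minimizer.\<close>

lemma pos_def_mat_trace_congruence:
  assumes K: "pos_def_mat A" and A: "A \<in> carrier_mat m m" and E: "E \<in> carrier_mat m n"
  shows "0 \<le> mat_trace (transpose_mat E * (A * E))"
    and "mat_trace (transpose_mat E * (A * E)) = 0 \<Longrightarrow> E = 0\<^sub>m m n"
proof -
  have nonneg: "0 \<le> col E j \<bullet> (A *\<^sub>v col E j)" if "j < n" for j
    using pos_def_matD(3)[OF K A] E that by auto
  show "0 \<le> mat_trace (transpose_mat E * (A * E))"
    unfolding mat_trace_congruence[OF A E] using nonneg by (intro sum_nonneg) auto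
  assume "mat_trace (transpose_mat E * (A * E)) = 0"
  hence "col E j \<bullet> (A *\<^sub>v col E j) = 0" if "j < n" for j
    unfolding mat_trace_congruence[OF A E] using nonneg that
    by (subst (asm) sum_nonneg_eq_0_iff) auto
  hence col0: "col E j = 0\<^sub>v m" if "j < n" for j
    using pos_def_matD(2)[OF K A, of "col E j"] E that by force
  show "E = 0\<^sub>m m n"
  proof (rule eq_matI)
    fix i j assume "i < dim_row (0\<^sub>m m n :: real mat)" "j < dim_col (0\<^sub>m m n :: real mat)"
    hence ij: "i < m" "j < n" by auto
    have "E $$ (i,j) = col E j $ i" using ij E by simp
    thus "E $$ (i,j) = 0\<^sub>m m n $$ (i,j)" using col0 ij by simp
  qed (use E in auto)
qed

lemma minus_mat_eq_0D:
  fixes A B :: "real mat"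
  assumes "A \<in> carrier_mat m n" "B \<in> carrier_mat m n" "A - B = 0\<^sub>m m n"
  shows "A = B"
proof (rule eq_matI)
  fix i j assume ij: "i < dim_row B" "j < dim_col B"
  have "A $$ (i,j) - B $$ (i,j) = (A - B) $$ (i,j)" using ij by simp
  also have "\<dots> = 0" unfolding assms(3) using ij assms(2) by simp
  finally show "A $$ (i,j) = B $$ (i,j)" by simp
qed (use assms in auto)

text \<open>The difference \<open>X - Y\<close> is annihilated by \<open>K\<close>, hence has
  squared norm zero in the sense of the preceding lemma. No inverse of \<open>K\<close> has to be
  constructed.\<close>

lemma pos_def_mat_mult_left_cancel:
  assumes K: "pos_def_mat K" "K \<in> carrier_mat m m"
    and X: "X \<in> carrier_mat m n" and Y: "Y \<in> carrier_mat m n" and eq: "K * X = K * Y"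
  shows "X = Y"
proof (rule minus_mat_eq_0D[OF X Y], rule pos_def_mat_trace_congruence(2)[OF K])
  show XY: "X - Y \<in> carrier_mat m n" using X Y by auto
  have "K * (X - Y) = 0\<^sub>m m n"
    using K(2) X Y eq by (simp add: mult_minus_distrib_mat[of K m m X n Y])
  thus "mat_trace (transpose_mat (X - Y) * (K * (X - Y))) = 0"
    using XY by (simp add: right_mult_zero_mat[of _ n m] mat_trace_zero)
qed

text \<open>With \<open>E = A - B\<close> the hypothesis reads \<open>A E + E B = 0\<close>, and both \<open>tr (E\<^sup>T A E)\<close> and
  \<open>tr (E B E\<^sup>T)\<close> are nonnegative.\<close>

lemma pos_def_mat_square_inject:
  assumes A: "pos_def_mat A" "A \<in> carrier_mat n n" and B: "pos_def_mat B" "B \<in> carrier_mat n n"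
    and eq: "A * A = B * B"
  shows "A = B"
proof -
  define E where "E = A - B"
  have E: "E \<in> carrier_mat n n" and Et: "transpose_mat E \<in> carrier_mat n n"
    unfolding E_def using A(2) B(2) by auto
  note mc = mult_carrier_mat[of _ n n _ n]
  have AE: "A * E \<in> carrier_mat n n" and EB: "E * B \<in> carrier_mat n n"
    using A(2) B(2) E by auto
  have "A * E = A * A - A * B"
    unfolding E_def using A(2) B(2) by (simp add: mult_minus_distrib_mat[of _ n n _ n])
  moreover have "E * B = A * B - B * B"
    unfolding E_def using A(2) B(2) by (simp add: minus_mult_distrib_mat[of _ n n _ _ n])
  ultimately have "A * E + E * B = 0\<^sub>m n n"
    unfolding eq using A(2) B(2) by (intro eq_matI) auto
  hence "transpose_mat E * (A * E) + transpose_mat E * (E * B) = 0\<^sub>m n n"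
    using mult_add_distrib_mat[OF Et AE EB] Et by (simp add: right_mult_zero_mat[of _ n n])
  hence "mat_trace (transpose_mat E * (A * E)) + mat_trace (transpose_mat E * (E * B)) = 0"
    using mat_trace_add[OF mc[OF Et AE] mc[OF Et EB]] by (simp add: mat_trace_zero)
  \<comment> \<open>Cyclicity turns the second trace into a congruence of \<open>B\<close>, with
    \<open>transpose_mat E\<close> in the role of \<open>E\<close>.\<close>
  moreover have "mat_trace (transpose_mat E * (E * B)) = mat_trace (E * B * transpose_mat E)"
    by (rule mat_trace_mult_comm[OF Et EB])
  moreover have "E * B * transpose_mat E
      = transpose_mat (transpose_mat E) * (B * transpose_mat E)"
    using E Et B(2) by simp
  ultimately have "mat_trace (transpose_mat E * (A * E)) = 0"
    using pos_def_mat_trace_congruence(1)[OF A E] pos_def_mat_trace_congruence(1)[OF B Et] by simp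
  hence "E = 0\<^sub>m n n" by (rule pos_def_mat_trace_congruence(2)[OF A E])
  thus ?thesis unfolding E_def by (rule minus_mat_eq_0D[OF A(2) B(2)])
qed

section \<open>Rank, diagonal matrices and orthogonal conjugation\<close>

text \<open>Each \<open>y\<close> is the image of \<open>R *\<^sub>v y\<close>, so the column space
  is everything. This fixes the inner dimension in \<open>compact_svd\<close>.\<close>

lemma rank_right_invertible:
  fixes X :: "real mat"
  assumes X: "X \<in> carrier_mat m n" and R: "R \<in> carrier_mat n m" and XR: "X * R = 1\<^sub>m m"
  shows "vec_space.rank m X = m"
proof -
  interpret vec_space "TYPE(real)" m .
  have "y \<in> col_space X" if y: "y \<in> carrier_vec m" for y
  proof -
    have "X *\<^sub>v (R *\<^sub>v y) = y"
      using assoc_mult_mat_vec[OF X R y] y unfolding XR by simp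
    moreover have "R *\<^sub>v y \<in> carrier_vec n" using R y by simp
    ultimately show ?thesis unfolding col_space_eq[OF X] using X y by auto
  qed
  moreover have "col_space X \<subseteq> carrier_vec m" unfolding col_space_eq[OF X] using X by auto
  ultimately have "span (set (cols X)) = carrier_vec m" unfolding col_space_def by auto
  thus ?thesis unfolding rank_def using dim_is_n by (simp add: module_vec_def)
qed

lemma diagonal_mat_mult_vec:
  fixes S :: "'a :: comm_semiring_1 mat"
  assumes S: "S \<in> carrier_mat n n" "diagonal_mat S" and y: "y \<in> carrier_vec n" and i: "i < n"
  shows "(S *\<^sub>v y) $ i = S $$ (i,i) * y $ i"
proof -
  have "(S *\<^sub>v y) $ i = (\<Sum>j<n. S $$ (i,j) * y $ j)"
    using S(1) y i by (simp add: scalar_prod_def atLeast0LessThan)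
  also have "\<dots> = (\<Sum>j<n. if j = i then S $$ (i,i) * y $ i else 0)"
    using S i unfolding diagonal_mat_def by (intro sum.cong) auto
  finally show ?thesis using i by simp
qed

lemma transpose_diagonal_mat:
  assumes "S \<in> carrier_mat n n" "diagonal_mat S"
  shows "transpose_mat S = S"
proof (rule eq_matI)
  fix i j assume "i < dim_row S" "j < dim_col S"
  thus "transpose_mat S $$ (i,j) = S $$ (i,j)"
    using assms unfolding diagonal_mat_def by (cases "i = j") auto
qed (use assms in auto)

text \<open>In the coordinates \<open>y = transpose_mat U *\<^sub>v x\<close> the quadratic form is
  a sum of squares with the positive weights \<open>S $$ (i, i)\<close>, and \<open>y\<close> is
  nonzero because \<open>U\<close> maps it back to \<open>x\<close>.\<close>

lemma pos_def_mat_orthogonal_conjugate: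
  assumes U: "U \<in> carrier_mat n n" "transpose_mat U * U = 1\<^sub>m n"
    and S: "S \<in> carrier_mat n n" "diagonal_mat S" "\<forall>i<n. 0 < S $$ (i,i)"
  shows "pos_def_mat (U * S * transpose_mat U)"
proof -
  have Ut: "transpose_mat U \<in> carrier_mat n n" using U by simp
  let ?A = "U * S * transpose_mat U"
  have "transpose_mat ?A = ?A"
    using U(1) Ut S(1) transpose_diagonal_mat[OF S(1,2)]
    by (simp add: transpose_mult[of _ n n _ n])
  moreover have "0 < x \<bullet> (?A *\<^sub>v x)" if x: "x \<in> carrier_vec n" "x \<noteq> 0\<^sub>v n" for x
  proof -
    define y where "y = transpose_mat U *\<^sub>v x"
    have y: "y \<in> carrier_vec n" unfolding y_def using Ut x by simp
    have "U *\<^sub>v y = x"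
      unfolding y_def using assoc_mult_mat_vec[OF U(1) Ut x(1)] x(1)
      by (simp add: orthogonal_transpose_right_inverse[OF U])
    hence "y \<noteq> 0\<^sub>v n" using U(1) x(2) by auto
    then obtain k where k: "k < n" "y $ k \<noteq> 0" using y by (metis eq_vecI carrier_vecD index_zero_vec)
    have "x \<bullet> (?A *\<^sub>v x) = x \<bullet> (U *\<^sub>v (S *\<^sub>v y))"
      unfolding y_def using U(1) Ut S(1) x by (simp add: assoc_mult_mat_vec[of _ n n _ n])
    also have "\<dots> = y \<bullet> (S *\<^sub>v y)"
      unfolding y_def using transpose_vec_mult_scalar[OF U(1) _ x(1)] S(1) Ut x(1) by simp
    also have "\<dots> = (\<Sum>i<n. S $$ (i,i) * (y $ i)\<^sup>2)"
      unfolding scalar_prod_def using diagonal_mat_mult_vec[OF S(1,2) y] S(1)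
      by (auto simp: atLeast0LessThan power2_eq_square intro!: sum.cong)
    also have "\<dots> > 0"
      using S(3) k by (intro sum_pos2[of _ k]) (auto simp: less_imp_le)
    finally show ?thesis .
  qed
  ultimately show ?thesis unfolding pos_def_mat_def using U(1) S(1) by auto
qed

text \<open>Each diagonal entry of \<open>D\<close> is the value of the quadratic form of
  \<open>K\<close> at the corresponding column of \<open>P\<close>, so positivity carries over to
  the spectral decomposition.\<close>

lemma pos_def_mat_diagonalization:
  assumes K: "pos_def_mat K" "K \<in> carrier_mat n n"
  shows "\<exists>P D. P \<in> carrier_mat n n \<and> D \<in> carrier_mat n n \<and> transpose_mat P * P = 1\<^sub>m n \<and>
           diagonal_mat D \<and> (\<forall>i<n. 0 < D $$ (i,i)) \<and> K = P * D * transpose_mat P"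
proof -
  obtain P D where P: "P \<in> carrier_mat n n" "transpose_mat P * P = 1\<^sub>m n"
    and D: "D \<in> carrier_mat n n" "diagonal_mat D" and KPD: "K = P * D * transpose_mat P"
    using real_symmetric_diagonalization[OF K(2) pos_def_matD(1)[OF K]] by auto
  have Pt: "transpose_mat P \<in> carrier_mat n n" using P by simp
  have "0 < D $$ (i,i)" if i: "i < n" for i
  proof -
    define u where "u = P *\<^sub>v unit_vec n i"
    have u: "u \<in> carrier_vec n" unfolding u_def using P by simp
    have Pu: "transpose_mat P *\<^sub>v u = unit_vec n i"
      unfolding u_def using assoc_mult_mat_vec[OF Pt P(1), of "unit_vec n i"] P(2) by simp
    have "u \<noteq> 0\<^sub>v n"
    proof
      assume "u = 0\<^sub>v n"
      moreover have "transpose_mat P *\<^sub>v 0\<^sub>v n = 0\<^sub>v n" using Pt by (intro eq_vecI) auto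
      ultimately have "unit_vec n i = (0\<^sub>v n :: real vec)" using Pu by simp
      thus False using i by (metis index_unit_vec(1) index_zero_vec(1) zero_neq_one)
    qed
    hence "0 < u \<bullet> (K *\<^sub>v u)" by (rule pos_def_matD(2)[OF K u])
    also have "u \<bullet> (K *\<^sub>v u) = u \<bullet> (P *\<^sub>v (D *\<^sub>v unit_vec n i))"
      unfolding KPD using P(1) Pt D(1) u Pu by (simp add: assoc_mult_mat_vec[of _ n n _ n])
    also have "\<dots> = unit_vec n i \<bullet> (D *\<^sub>v unit_vec n i)"
      using transpose_vec_mult_scalar[OF P(1) _ u, of "D *\<^sub>v unit_vec n i"] D(1) Pu by simp
    also have "\<dots> = D $$ (i,i)"
      using i D(1) diagonal_mat_mult_vec[OF D, of "unit_vec n i" i] by simp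
    finally show ?thesis .
  qed
  thus ?thesis using P D KPD by blast
qed

section \<open>The matrix sign of a polar decomposition\<close>

text \<open>The product \<open>K * Y\<close> has full row rank \<open>m\<close>. So in every compact
  singular value decomposition of it \<open>U\<close> and \<open>S\<close> are square of size
  \<open>m\<close>, and \<open>U * S * transpose_mat U\<close> can be compared with
  \<open>K\<close>.\<close>

theorem msgn_pos_def_mult:
  assumes K: "pos_def_mat K" "K \<in> carrier_mat m m" and Y: "Y \<in> carrier_mat m n"
    and YY: "Y * transpose_mat Y = 1\<^sub>m m" and m: "m > 0"
  shows "msgn (K * Y) = Y"
proof -
  let ?X = "K * Y"
  have X: "?X \<in> carrier_mat m n" using K(2) Y by simp
  have Yt: "transpose_mat Y \<in> carrier_mat n m" using Y by simp
  obtain P D where P: "P \<in> carrier_mat m m" "transpose_mat P * P = 1\<^sub>m m"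
    and D: "D \<in> carrier_mat m m" "diagonal_mat D" "\<forall>i<m. 0 < D $$ (i,i)"
    and KPD: "K = P * D * transpose_mat P"
    using pos_def_mat_diagonalization[OF K] by auto
  have Pt: "transpose_mat P \<in> carrier_mat m m" using P by simp
  have PPt: "P * transpose_mat P = 1\<^sub>m m" by (rule orthogonal_transpose_right_inverse[OF P])
  have "det K \<noteq> 0"
  proof
    assume "det K = 0"
    then obtain v where "v \<in> carrier_vec m" "v \<noteq> 0\<^sub>v m" "K *\<^sub>v v = 0\<^sub>v m"
      using det_0_iff_vec_prod_zero_field[OF K(2)] by auto
    thus False using pos_def_matD(2)[OF K] by force
  qed
  \<comment> \<open>\<open>L\<close> is an inverse of \<open>K\<close>, so
    \<open>transpose_mat Y * L\<close> is a right inverse of \<open>K * Y\<close>. The term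
    \<open>undefined\<close> only fills the dummy parameter of the matrix ring.\<close>
  then obtain L where L: "L \<in> carrier_mat m m" "K * L = 1\<^sub>m m"
    using det_non_zero_imp_unit[OF K(2), of undefined]
    unfolding Units_def by (auto simp: ring_mat_simps)
  have "?X * (transpose_mat Y * L) = K * ((Y * transpose_mat Y) * L)"
    using K(2) Y Yt L(1) by (simp add: assoc_mult_mat[of _ m n _ m _ m] assoc_mult_mat[of _ m m _ n _ m])
  also have "\<dots> = 1\<^sub>m m" unfolding YY using L by simp
  finally have rank: "vec_space.rank m ?X = m"
    using Yt L(1) by (intro rank_right_invertible[OF X, of "transpose_mat Y * L"]) auto
  \<comment> \<open>This excludes the zero branch of \<open>msgn\<close>; \<open>m > 0\<close>
    provides a diagonal entry at which the identity differs from zero.\<close>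
  have nonzero: "?X \<noteq> 0\<^sub>m m n"
  proof
    assume "?X = 0\<^sub>m m n"
    hence "K * Y = K * 0\<^sub>m m n" using K(2) by (simp add: right_mult_zero_mat[of _ m m])
    hence "Y = 0\<^sub>m m n" by (rule pos_def_mat_mult_left_cancel[OF K Y zero_carrier_mat])
    hence "1\<^sub>m m = (0\<^sub>m m m :: real mat)" using YY Yt by (simp add: left_mult_zero_mat[of _ n m])
    hence "(1\<^sub>m m :: real mat) $$ (0,0) = 0\<^sub>m m m $$ (0,0)" by simp
    thus False using m by simp
  qed
  have exists: "compact_svd ?X P D (transpose_mat Y * P)" (is "compact_svd _ _ _ ?V")
  proof -
    have V: "?V \<in> carrier_mat n m" using Yt P(1) by simp
    have Vt: "transpose_mat ?V = transpose_mat P * Y"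
      using transpose_mult[OF Yt P(1)] by simp
    have "transpose_mat ?V * ?V = transpose_mat P * ((Y * transpose_mat Y) * P)"
      unfolding Vt using P(1) Pt Y Yt
      by (simp add: assoc_mult_mat[of _ m n _ m _ m] assoc_mult_mat[of _ m m _ n _ m])
    also have "\<dots> = 1\<^sub>m m" unfolding YY using P by simp
    finally have VV: "transpose_mat ?V * ?V = 1\<^sub>m m" .
    have XPD: "?X = P * D * transpose_mat ?V"
      unfolding Vt KPD using P(1) Pt D(1) Y
      by (simp add: assoc_mult_mat[of _ m m _ m _ n])
    have dims: "dim_row ?X = m" "dim_col ?X = n" using X by auto
    show ?thesis
      unfolding compact_svd_def Let_def dims rank by (intro conjI P D V VV XPD)
  qed
  have YPP: "P * transpose_mat (transpose_mat Y * P) = Y"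
    unfolding transpose_mult[OF Yt P(1)] using assoc_mult_mat[OF P(1) Pt Y] PPt Y by simp
  have unique: "U * transpose_mat V = Y" if "compact_svd ?X U S V" for U S V
  proof -
    have U: "U \<in> carrier_mat m m" "transpose_mat U * U = 1\<^sub>m m"
      and V: "V \<in> carrier_mat n m" "transpose_mat V * V = 1\<^sub>m m"
      and S: "S \<in> carrier_mat m m" "diagonal_mat S" "\<forall>i<m. 0 < S $$ (i,i)"
      and XU: "?X = U * S * transpose_mat V"
      using that K(2) Y rank unfolding compact_svd_def Let_def by auto
    have Ut: "transpose_mat U \<in> carrier_mat m m" and Vt: "transpose_mat V \<in> carrier_mat m n"
      using U V by auto
    define A where "A = U * S * transpose_mat U"
    have A: "A \<in> carrier_mat m m" unfolding A_def using U S Ut by auto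
    have Apd: "pos_def_mat A"
      unfolding A_def by (rule pos_def_mat_orthogonal_conjugate[OF U S])
    note as = assoc_mult_mat[of _ m m _ m _ m] assoc_mult_mat[of _ m n _ m _ m]
      assoc_mult_mat[of _ m m _ n _ m] assoc_mult_mat[of _ m m _ m _ n] 
    have Xt: "transpose_mat ?X = V * (S * transpose_mat U)"
      unfolding XU using U(1) S(1) V(1) Vt Ut transpose_diagonal_mat[OF S(1,2)]
      by (simp add: transpose_mult[of _ m m _ m] transpose_mult[of _ m m _ n])
    have "?X * transpose_mat ?X = U * (S * ((transpose_mat V * V) * (S * transpose_mat U)))"
      unfolding Xt unfolding XU using U(1) Ut S(1) V(1) Vt
      by (simp add: as assoc_mult_mat[of _ m n _ m _ m])
    \<comment> \<open>Both inner products of columns are the identity, so \<open>V\<close> may be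
      exchanged for \<open>U\<close>; this turns the product into the square of
      \<open>A\<close>.\<close>
    also have "\<dots> = U * (S * ((transpose_mat U * U) * (S * transpose_mat U)))"
      unfolding U(2) V(2) ..
    also have "\<dots> = A * A"
      unfolding A_def using U(1) Ut S(1) by (simp add: as)
    finally have XX1: "?X * transpose_mat ?X = A * A" .
    have "?X * transpose_mat ?X = K * ((Y * transpose_mat Y) * K)"
      using K(2) Y Yt pos_def_matD(1)[OF K] by (simp add: transpose_mult[of _ m m _ n] as)
    also have "\<dots> = K * K" unfolding YY using K(2) by simp
    finally have "A = K"
      using XX1 by (intro pos_def_mat_square_inject[OF Apd A K]) simp
    \<comment> \<open>With \<open>K\<close> written as \<open>U * S * transpose_mat U\<close>, the
      factor \<open>transpose_mat U * U\<close> collapses and \<open>K * Y\<close> is recovered.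
      Cancelling \<open>K\<close> then identifies the outer factors with \<open>Y\<close>.\<close>
    have "K * (U * transpose_mat V) = U * (S * ((transpose_mat U * U) * transpose_mat V))"
      unfolding \<open>A = K\<close>[symmetric] A_def using U(1) Ut S(1) Vt by (simp add: as)
    also have "\<dots> = ?X" unfolding U(2) XU using U(1) S(1) Vt by (simp add: as)
    finally show ?thesis by (rule pos_def_mat_mult_left_cancel[OF K mult_carrier_mat[OF U(1) Vt] Y])
  qed
  have "(THE Z. \<exists>U S V. compact_svd ?X U S V \<and> Z = U * transpose_mat V) = Y"
  proof (rule the_equality)
    show "\<exists>U S V. compact_svd ?X U S V \<and> Y = U * transpose_mat V"
      using exists YPP by metis
  qed (use unique in blast)
  thus ?thesis unfolding msgn_def using nonzero X K(2) Y by simp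
qed

section \<open>Minimizing the objective\<close>

text \<open>Completing the square: with \<open>b\<close> the inner product weighted by
  \<open>H\<close>, the linear term is \<open>- d / N * b Q D\<close> and the quadratic one is
  \<open>d / (2 * N) * b Q Q\<close>, so the center is \<open>D\<close>.\<close>

lemma objective_isotropic:
  assumes N: "N \<ge> 1" and H: "H \<in> carrier_mat m m" "transpose_mat H = H"
    and D: "D \<in> carrier_mat m n" and Q: "Q \<in> carrier_mat m n"
    and ZZ: "Z * transpose_mat Z = d \<cdot>\<^sub>m 1\<^sub>m n" and G: "G = (d / real N) \<cdot>\<^sub>m (H * D)"
  shows "objective N H Z G Q = d / (2 * real N) *
    (mat_trace (transpose_mat (Q - D) * (H * (Q - D))) - mat_trace (transpose_mat D * (H * D)))"
proof -
  define b where "b X Y = mat_trace (transpose_mat X * (H * Y))" for X Y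
  have HD: "H * D \<in> carrier_mat m n" and HQ: "H * Q \<in> carrier_mat m n" using H D Q by auto
  \<comment> \<open>Symmetry of \<open>H\<close> makes the two cross terms of the square
    equal.\<close>
  have bsym: "b D Q = b Q D"
  proof -
    have "transpose_mat (transpose_mat Q * (H * D)) = transpose_mat D * (H * Q)"
      using Q D H by (simp add: transpose_mult[of _ n m _ n] transpose_mult[of _ m m _ n]
          assoc_mult_mat[of _ n m _ m _ n])
    moreover have "transpose_mat Q * (H * D) \<in> carrier_mat n n" using Q H D by auto
    ultimately show ?thesis unfolding b_def using mat_trace_transpose by metis
  qed
  have sq: "b (Q - D) (Q - D) = b Q Q - 2 * b Q D + b D D"
  proof -
    have Qt: "transpose_mat Q \<in> carrier_mat n m" and Dt: "transpose_mat D \<in> carrier_mat n m"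
      using Q D by auto
    have "transpose_mat (Q - D) * (H * (Q - D)) =
      (transpose_mat Q - transpose_mat D) * (H * Q - H * D)"
      by (simp only: transpose_minus[OF Q D] mult_minus_distrib_mat[OF H(1) Q D])
    also have "\<dots> = (transpose_mat Q * (H * Q) - transpose_mat Q * (H * D)) -
      (transpose_mat D * (H * Q) - transpose_mat D * (H * D))"
      by (simp only: minus_mult_distrib_mat[OF Qt Dt minus_carrier_mat[OF HD]]
          mult_minus_distrib_mat[OF Qt HQ HD] mult_minus_distrib_mat[OF Dt HQ HD])
    finally have "transpose_mat (Q - D) * (H * (Q - D)) =
      (transpose_mat Q * (H * Q) - transpose_mat Q * (H * D)) -
      (transpose_mat D * (H * Q) - transpose_mat D * (H * D))" .
    moreover have "transpose_mat X * (H * Y) \<in> carrier_mat n n"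
      if "X \<in> carrier_mat m n" "Y \<in> carrier_mat m n" for X Y using that H(1) by auto
    ultimately show ?thesis unfolding b_def using Q D bsym[unfolded b_def]
      by (simp add: mat_trace_minus[of _ n] minus_carrier_mat)
  qed
  have "Q * transpose_mat G = (d / real N) \<cdot>\<^sub>m (Q * transpose_mat (H * D))"
  proof -
    have "transpose_mat G = (d / real N) \<cdot>\<^sub>m transpose_mat (H * D)" unfolding G by (rule eq_matI) auto
    thus ?thesis using Q HD by (simp add: mult_smult_distrib[of _ m n _ m])
  qed
  moreover have "Q * transpose_mat (H * D) \<in> carrier_mat m m" using Q HD by auto
  moreover have "mat_trace (Q * transpose_mat (H * D)) = b Q D"
  proof -
    have "mat_trace (Q * transpose_mat (H * D)) = mat_trace (transpose_mat (H * D) * Q)"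
      using Q HD by (intro mat_trace_mult_comm[of _ m n]) auto
    also have "transpose_mat (H * D) * Q = transpose_mat D * (H * Q)"
      using H D Q by (simp add: transpose_mult[OF H(1) D] assoc_mult_mat[of _ n m _ m _ n])
    finally show ?thesis unfolding bsym[symmetric] unfolding b_def .
  qed
  ultimately have lin: "mat_trace (Q * transpose_mat G) = d / real N * b Q D"
    by (simp add: mat_trace_smult)
  have "H * Q * (Z * transpose_mat Z) * transpose_mat Q = d \<cdot>\<^sub>m ((H * Q) * transpose_mat Q)"
    unfolding ZZ using HQ Q
    by (simp add: mult_smult_distrib[of _ m n _ n] mult_smult_assoc_mat[of _ m n _ m])
  moreover have "(H * Q) * transpose_mat Q \<in> carrier_mat m m" using HQ Q by auto
  moreover have "mat_trace ((H * Q) * transpose_mat Q) = b Q Q"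
    unfolding b_def using HQ Q by (intro mat_trace_mult_comm[of _ m n]) auto
  ultimately have quad: "mat_trace (H * Q * (Z * transpose_mat Z) * transpose_mat Q) = d * b Q Q"
    by (simp add: mat_trace_smult)
  show ?thesis
    unfolding objective_def lin quad b_def[symmetric] sq using N by (simp add: field_simps)
qed

theorem corollary1:
  fixes m n N :: nat and W Wstar G Z H :: "real mat"
  assumes "m \<ge> 1" and "n \<ge> 1" and "N \<ge> 1"
    and "W \<in> carrier_mat m n" and "Wstar \<in> carrier_mat m n" and "G \<in> carrier_mat m n"
    and "Z \<in> carrier_mat n N" and "H \<in> carrier_mat m m"
    and "transpose_mat H = H"
    and "pos_def_mat H" and "pos_def_mat (Z * transpose_mat Z)"
    and "G = (1 / real N) \<cdot>\<^sub>m (H * (W - Wstar) * (Z * transpose_mat Z))"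
    and "(W - Wstar) * transpose_mat (W - Wstar) \<propto> 1\<^sub>m m"
    and "Z * transpose_mat Z \<propto> 1\<^sub>m n"
  shows "(\<exists>!Qstar. is_arg_min (objective N H Z G) (\<lambda>Q. Q \<in> carrier_mat m n) Qstar) \<and>
    (\<forall>Qstar. is_arg_min (objective N H Z G) (\<lambda>Q. Q \<in> carrier_mat m n) Qstar
       \<longrightarrow> Qstar \<propto> msgn G)"
proof -
  note m = assms(1) and N = assms(3) and H = assms(8) and Hpd = assms(10)
  define D where "D = W - Wstar"
  have D: "D \<in> carrier_mat m n" unfolding D_def using assms(4,5) by auto
  have HD: "H * D \<in> carrier_mat m n" using H D by simp
  obtain c where c: "c > 0" "D * transpose_mat D = c \<cdot>\<^sub>m 1\<^sub>m m"
    using assms(13) unfolding pos_prop_def D_def by auto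
  obtain d where d: "d > 0" "Z * transpose_mat Z = d \<cdot>\<^sub>m 1\<^sub>m n"
    using assms(14) unfolding pos_prop_def by auto
  have G: "G = (d / real N) \<cdot>\<^sub>m (H * D)"
    unfolding assms(12) D_def[symmetric] d(2)
    using HD by (simp add: mult_smult_distrib[of _ m n _ n] smult_smult_mat right_mult_one_mat[of _ m])
  define a where "a = d / (2 * real N)"
  have a: "a > 0" unfolding a_def using d N by simp
  \<comment> \<open>This is the squared distance from \<open>Q\<close> to \<open>D\<close> in the
    inner product weighted by \<open>H\<close>. The objective is \<open>a\<close> times it, up to a
    constant, so minimizing one minimizes the other.\<close>
  define dist where "dist Q = mat_trace (transpose_mat (Q - D) * (H * (Q - D)))" for Q
  have obj: "objective N H Z G Q = a * (dist Q - mat_trace (transpose_mat D * (H * D)))"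
    if "Q \<in> carrier_mat m n" for Q
    unfolding dist_def a_def by (rule objective_isotropic[OF N H assms(9) D that d(2) G])
  have dist_nonneg: "dist Q \<ge> 0" if "Q \<in> carrier_mat m n" for Q
    unfolding dist_def using that D by (intro pos_def_mat_trace_congruence(1)[OF Hpd H]) auto
  have dist0: "dist D = 0"
  proof -
    have "D - D = 0\<^sub>m m n" using D by (intro eq_matI) auto
    thus ?thesis unfolding dist_def using H
      by (simp add: right_mult_zero_mat[of _ m m] right_mult_zero_mat[of _ n m] mat_trace_zero)
  qed
  have min: "is_arg_min (objective N H Z G) (\<lambda>Q. Q \<in> carrier_mat m n) D"
    unfolding is_arg_min_linorder using D a dist_nonneg by (simp add: obj dist0 right_diff_distrib)
  have uniq: "Q = D" if "is_arg_min (objective N H Z G) (\<lambda>Q. Q \<in> carrier_mat m n) Q" for Q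
  proof -
    have Q: "Q \<in> carrier_mat m n" and "objective N H Z G Q \<le> objective N H Z G D"
      using that D unfolding is_arg_min_linorder by auto
    \<comment> \<open>Comparison with the value at \<open>D\<close>, where the distance is zero,
      gives \<open>a * dist Q \<le> 0\<close>.\<close>
    hence "dist Q = 0" using a D dist_nonneg[OF Q]
      by (simp add: obj dist0 right_diff_distrib mult_le_0_iff)
    hence "Q - D = 0\<^sub>m m n"
      unfolding dist_def using Q D by (intro pos_def_mat_trace_congruence(2)[OF Hpd H]) auto
    thus ?thesis by (rule minus_mat_eq_0D[OF Q D])
  qed
  \<comment> \<open>The factor \<open>1 / sqrt c\<close> makes the rows of \<open>Y\<close>
    orthonormal; \<open>K\<close> absorbs \<open>sqrt c\<close> together with \<open>d / N\<close>,
    so that \<open>K * Y\<close> is \<open>G\<close>.\<close>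
  define Y where "Y = (1 / sqrt c) \<cdot>\<^sub>m D"
  define K where "K = (d * sqrt c / real N) \<cdot>\<^sub>m H"
  have Y: "Y \<in> carrier_mat m n" and K: "K \<in> carrier_mat m m"
    unfolding Y_def K_def using D H by auto
  have "pos_def_mat K" unfolding K_def using c d N by (intro pos_def_mat_smult[OF Hpd]) simp
  moreover have "Y * transpose_mat Y = 1\<^sub>m m"
  proof -
    have "transpose_mat Y = (1 / sqrt c) \<cdot>\<^sub>m transpose_mat D" unfolding Y_def by (rule eq_matI) auto
    hence "Y * transpose_mat Y = (1 / sqrt c * (1 / sqrt c)) \<cdot>\<^sub>m (D * transpose_mat D)"
      unfolding Y_def using D
      by (simp add: mult_smult_distrib[of _ m n _ m] mult_smult_assoc_mat[of _ m n _ m] smult_smult_mat)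
    also have "\<dots> = 1\<^sub>m m" unfolding c(2) using c(1) by (intro eq_matI) auto
    finally show ?thesis .
  qed
  moreover have "G = K * Y"
    unfolding G K_def Y_def using H D HD c(1)
    by (simp add: mult_smult_distrib[of _ m m _ n] mult_smult_assoc_mat[of _ m m _ n] smult_smult_mat)
  ultimately have "msgn G = Y" using msgn_pos_def_mult[OF _ K Y] m by simp
  hence "D = sqrt c \<cdot>\<^sub>m msgn G" unfolding Y_def using c(1) D
    by (intro eq_matI) auto
  hence "D \<propto> msgn G" unfolding pos_prop_def using c(1) by (intro exI[of _ "sqrt c"]) simp
  thus ?thesis using min uniq by blast
qed

end
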